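(* Let $N\ge 1$, and consider the quantity $$B_N=\left[\sum_{k=1}^{N}\Gamma_k^{-1}\omega_k\left(1-L_\Psi\omega_k\right)\right]^{-1}\left[\frac{\|x_0-x^*\|^2}{\delta_1}+\frac{2L_h}{\Gamma_N}\left(\|x^*\|^2+M^2\right)\right]$$ (the complexity upper bound) as a function of hyperparameters $\{\alpha_k\}_{k=1}^N,\{\delta_k\}_{k=1}^N,\{\omega_k\}_{k=1}^N$ with $\alpha_1=1$, $0<\alpha_k<1$ for $2\le k\le N$, $\delta_k>0$, $\omega_k>0$, where $\Gamma_1=1$ and $\Gamma_k=(1-\alpha_k)\Gamma_{k-1}$ for $k\ge2$. Assume that the hyperparameters are required to satisfy $$\alpha_k\delta_k\le\omega_k<\frac1{L_\Psi}\quad (k=1,\dots,N),\qquad \frac{\alpha_1}{\delta_1\Gamma_1}\ge\frac{\alpha_2}{\delta_2\Gamma_2}\ge\cdots\ge\frac{\alpha_N}{\delta_N\Gamma_N},$$ that $\delta_1=\omega_k=\omega$ for all $k=1,\dots,N$ (a constant $\omega>0$, itself to be chosen), and that $h=0$ (so that $L_h=0$). Then, among all hyperparameters satisfying these requirements, $B_N$ is minimized by the choice $$\bar\alpha_1=1,\qquad \bar\alpha_{k+1}=\frac{2}{1+\sqrt{1+\frac{4}{\bar\alpha_k^2}}},\qquad \bar\delta_{k+1}=\frac{\bar\omega}{\bar\alpha_{k+1}}\quad(k=1,\dots,N-1),\qquad \bar\omega=\frac{2}{3L_\Psi},$$ with $\bar\delta_1=\omega_k=\bar\omega$ for all $k$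.
   Context: The setting is the composite problem $\min_{x\in\mathbb{R}^{q+1}}\Psi(x)+\chi(x)$, $\Psi=f+h$, where $f$ is convex with $L_f$-Lipschitz gradient, $h$ is possibly nonconvex with $L_h$-Lipschitz gradient, and $\chi$ is convex over a bounded domain; $L_\Psi>0$ is the Lipschitz constant of $\nabla\Psi$. It is treated by the accelerated gradient algorithm with hyperparameters $\{\alpha_k\},\{\delta_k\},\{\omega_k\}$: $x_0^{ag}=x_0$, $x_k^{md}=\alpha_kx_{k-1}^{ag}+(1-\alpha_k)x_{k-1}$, $x_k=\mathcal{P}(x_{k-1},\nabla\Psi(x_k^{md}),\delta_k)$, $x_k^{ag}=\mathcal{P}(x_k^{md},\nabla\Psi(x_k^{md}),\omega_k)$, where $\mathcal{P}(x,y,c)=\arg\min_u\{\langle y,u\rangle+\frac1{2c}\|u-x\|^2+\chi(u)\}$. The quantity $B_N$ is a known upper bound for $\min_{k=1,\dots,N}\|\mathcal{G}(x_k^{md},\nabla\Psi(x_k^{md}),\omega_k)\|^2$, where $\mathcal{G}(x,y,c)=\frac1c[x-\mathcal{P}(x,y,c)]$. Here $x_0$ (starting point), $x^*$ (a minimizer) and $M$ are fixed and do not depend on the hyperparameters; only the formula for $B_N$ matters for the statement. *)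

theory Defs
  imports "HOL-Analysis.Analysis"
begin

definition has_lipschitz_gradient :: "('a::real_inner \<Rightarrow> real) \<Rightarrow> real \<Rightarrow> bool" where
  "has_lipschitz_gradient g L \<longleftrightarrow>
     (\<exists>G. (\<forall>x. GDERIV g x :> G x) \<and> L-lipschitz_on UNIV G)"

text \<open>
  The extended-valued convex term \<open>chi\<close> is given by its bounded effective domain \<open>D\<close> and its
  real values on \<open>D\<close>; values of \<open>chi\<close> off \<open>D\<close> are irrelevant (read them as infinite), so a
  minimizer of \<open>f + h + chi\<close> is a minimizer over \<open>D\<close>.
\<close>

definition composite_problem ::
  "('a::euclidean_space \<Rightarrow> real) \<Rightarrow> ('a \<Rightarrow> real) \<Rightarrow> ('a \<Rightarrow> real) \<Rightarrow> 'a set \<Rightarrow>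
   real \<Rightarrow> real \<Rightarrow> real \<Rightarrow> 'a \<Rightarrow> bool" where
  "composite_problem f h chi D Lf Lh L\<Psi> xstar \<longleftrightarrow>
     convex_on UNIV f \<and> has_lipschitz_gradient f Lf \<and>
     has_lipschitz_gradient h Lh \<and>
     bounded D \<and> convex_on D chi \<and>
     0 < L\<Psi> \<and> has_lipschitz_gradient (\<lambda>x. f x + h x) L\<Psi> \<and>
     xstar \<in> D \<and> (\<forall>x\<in>D. f xstar + h xstar + chi xstar \<le> f x + h x + chi x)"

text \<open>
  Hyperparameters are sequences indexed from 1; index 0 is never used, and the value of
  \<open>Gam\<close> there is a dummy. The recursion starts at 2 because \<open>1 - \<alpha> 1 = 0\<close>.
\<close>

fun Gam :: "(nat \<Rightarrow> real) \<Rightarrow> nat \<Rightarrow> real" where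
  "Gam \<alpha> 0 = 1"
| "Gam \<alpha> (Suc 0) = 1"
| "Gam \<alpha> (Suc (Suc k)) = (1 - \<alpha> (Suc (Suc k))) * Gam \<alpha> (Suc k)"

definition complexity_bound ::
  "real \<Rightarrow> real \<Rightarrow> 'a::euclidean_space \<Rightarrow> 'a \<Rightarrow> real \<Rightarrow> nat \<Rightarrow>
   (nat \<Rightarrow> real) \<Rightarrow> (nat \<Rightarrow> real) \<Rightarrow> (nat \<Rightarrow> real) \<Rightarrow> real" where
  "complexity_bound L\<Psi> Lh x0 xstar M N \<alpha> \<delta> \<omega> =
     inverse (\<Sum>k=1..N. inverse (Gam \<alpha> k) * \<omega> k * (1 - L\<Psi> * \<omega> k)) *
     ((norm (x0 - xstar))\<^sup>2 / \<delta> 1 + 2 * Lh / Gam \<alpha> N * ((norm xstar)\<^sup>2 + M\<^sup>2))"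

definition feasible ::
  "real \<Rightarrow> nat \<Rightarrow> (nat \<Rightarrow> real) \<Rightarrow> (nat \<Rightarrow> real) \<Rightarrow> (nat \<Rightarrow> real) \<Rightarrow> bool" where
  "feasible L\<Psi> N \<alpha> \<delta> \<omega> \<longleftrightarrow>
     \<alpha> 1 = 1 \<and>
     (\<forall>k\<in>{2..N}. 0 < \<alpha> k \<and> \<alpha> k < 1) \<and>
     (\<forall>k\<in>{1..N}. 0 < \<delta> k \<and> 0 < \<omega> k) \<and>
     (\<forall>k\<in>{1..N}. \<alpha> k * \<delta> k \<le> \<omega> k \<and> \<omega> k < 1 / L\<Psi>) \<and>
     (\<forall>k\<in>{1..<N}. \<alpha> k / (\<delta> k * Gam \<alpha> k) \<ge> \<alpha> (k + 1) / (\<delta> (k + 1) * Gam \<alpha> (k + 1))) \<and>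
     (\<exists>w>0. \<delta> 1 = w \<and> (\<forall>k\<in>{1..N}. \<omega> k = w))"

end

(* With L_h = 0 the bound is |x0 - x*|^2 / (w^2 (1 - L w) S), where S is the sum of the 1/Gamma_k,
   so w and the alpha_k are optimised separately: w^2 (1 - L w) is largest at w = 2/(3L).
   Chaining the monotonicity constraint down to k = 1 and using alpha_k delta_k <= w gives
   alpha_k^2 <= Gamma_k. For t_k = Gamma_k^(-1/2) this reads t_k^2 - t_k <= t_(k-1)^2, and the
   given alpha_k attain equality at every step, hence maximise every 1/Gamma_k at once. *)

theory Submission
  imports Defs
begin

lemma Gam_Suc: "k \<ge> 1 \<Longrightarrow> Gam \<alpha> (Suc k) = (1 - \<alpha> (Suc k)) * Gam \<alpha> k"
  by (cases k) auto

lemma Gam_pos: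
  assumes "\<And>k. k \<in> {2..N} \<Longrightarrow> \<alpha> k < 1" and "k \<in> {1..N}"
  shows "Gam \<alpha> k > 0"
proof -
  from assms(2) have "1 \<le> k" by simp
  then show ?thesis using assms(2)
  proof (induction k rule: dec_induct)
    case (step k)
    with assms(1)[of "Suc k"] show ?case by (simp add: Gam_Suc)
  qed simp
qed

text \<open>The difference of the two sides factors as \<open>(t - s) * (t + s - 1)\<close>, and
  both factors would be positive if \<open>t > s \<ge> 1\<close>. This inverts the recursion
  satisfied by the inverse square roots of \<open>Gam\<close>.\<close>

lemma le_of_square_minus_self_le:
  fixes s t :: real
  assumes "t\<^sup>2 - t \<le> s\<^sup>2 - s" and "s \<ge> 1"
  shows "t \<le> s"
proof (rule ccontr)
  assume "\<not> t \<le> s"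
  then have "(t - s) * (t + s - 1) > 0" using \<open>s \<ge> 1\<close> by (intro mult_pos_pos) auto
  with assms(1) show False by (simp add: algebra_simps power2_eq_square)
qed

text \<open>The cubic \<open>w\<^sup>2 * (1 - L * w)\<close> has its positive critical point at
  \<open>v\<close>, so its gap to the value there has the double root \<open>w = v\<close>; the
  remaining linear factor is positive for all \<open>w > 0\<close>, with no upper bound on
  \<open>w\<close>.\<close>

lemma stepsize_product_le:
  fixes L v w :: real
  assumes "L > 0" and "w > 0" and v: "v = 2 / (3 * L)"
  shows "w * (w * (1 - L * w)) \<le> v * (v * (1 - L * v))"
proof -
  have Lv: "L * v = 2/3" and "v > 0" using assms(1) by (simp_all add: v)
  \<comment> \<open>A polynomial identity in free \<open>L\<close>, \<open>v\<close>,
    \<open>w\<close>: the last term collects what vanishes once \<open>L * v = 2/3\<close>, which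
    avoids substituting the fraction for \<open>v\<close>.\<close>
  have "2 * (v * (v * (1 - L * v)) - w * (w * (1 - L * w))) =
      L * ((w - v)\<^sup>2 * (2 * w + v)) + (v\<^sup>2 - w\<^sup>2) * (2 - 3 * (L * v))"
    by (simp add: algebra_simps power2_eq_square)
  moreover have "2 - 3 * (L * v) = 0" using Lv by simp
  moreover have "L * ((w - v)\<^sup>2 * (2 * w + v)) \<ge> 0"
    using assms(1,2) \<open>v > 0\<close> by (intro mult_nonneg_nonneg) auto
  ultimately have "2 * (v * (v * (1 - L * v)) - w * (w * (1 - L * w))) \<ge> 0"
    by (simp only: mult_zero_right add_0_right)
  then show ?thesis by (simp only: zero_le_mult_iff diff_ge_0_iff_ge) simp
qed

text \<open>Eliminates \<open>\<delta>\<close>: the chained ratios bound \<open>\<delta> k\<close>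
  below by \<open>w * \<alpha> k / Gam \<alpha> k\<close>, the coupling constraint bounds it above
  by \<open>w / \<alpha> k\<close>, and the two bounds must be compatible.\<close>

lemma feasible_alpha_square_le_Gam:
  assumes "feasible L N \<alpha> \<delta> \<omega>" and k: "k \<in> {1..N}"
  shows "(\<alpha> k)\<^sup>2 \<le> Gam \<alpha> k"
proof -
  note F = assms(1)[unfolded feasible_def]
  from F obtain w where w: "w > 0" "\<delta> 1 = w" "\<And>k. k \<in> {1..N} \<Longrightarrow> \<omega> k = w" by blast
  have "1 \<le> k" using k by simp
  then have chain: "\<alpha> k / (\<delta> k * Gam \<alpha> k) \<le> 1 / w" using k
  proof (induction k rule: dec_induct)
    case base
    show ?case using F w by simp
  next
    case (step k)
    then have "\<alpha> (k + 1) / (\<delta> (k + 1) * Gam \<alpha> (k + 1)) \<le> \<alpha> k / (\<delta> k * Gam \<alpha> k)"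
      using F by simp
    with step show ?case by simp
  qed
  have pos: "Gam \<alpha> k > 0" using F by (intro Gam_pos[OF _ k]) simp
  have ap: "\<alpha> k > 0" using F k by (cases "k = 1") auto
  have dp: "\<delta> k > 0" and ad: "\<alpha> k * \<delta> k \<le> w" using F w k by auto
  from chain have "\<alpha> k * w \<le> \<delta> k * Gam \<alpha> k"
    using pos dp w(1) by (simp add: field_simps)
  then have "\<alpha> k * (\<alpha> k * w) \<le> \<alpha> k * (\<delta> k * Gam \<alpha> k)"
    using ap by (intro mult_left_mono) auto
  also have "\<dots> \<le> w * Gam \<alpha> k"
    using ad pos by (simp add: mult_right_mono flip: mult.assoc)
  finally show ?thesis using w(1) by (simp add: power2_eq_square)
qed

text \<open>\<open>b\<close> is the positive root of
  \<open>b\<^sup>2 + a\<^sup>2 * b - a\<^sup>2 = 0\<close> in rationalized form; with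
  \<open>s\<close> the square root, everything follows from
  \<open>(s - 1) * (s + 1) = 4 / a\<^sup>2\<close>.\<close>

lemma nesterov_step:
  fixes a b :: real
  assumes "a > 0" and b: "b = 2 / (1 + sqrt (1 + 4 / a\<^sup>2))"
  shows "0 < b" "b < 1" "(1 - b) * a\<^sup>2 = b\<^sup>2"
proof -
  define s where "s = sqrt (1 + 4 / a\<^sup>2)"
  have s: "s > 1" "s\<^sup>2 = 1 + 4 / a\<^sup>2" using assms by (simp_all add: s_def)
  have b': "b = 2 / (1 + s)" by (simp add: b s_def)
  show "0 < b" "b < 1" using s b' by simp_all
  have "1 - b = (s - 1) / (1 + s)" using s b' by (simp add: field_simps)
  moreover have "(s - 1) * (1 + s) * a\<^sup>2 = 4"
    using s(2) assms(1) by (simp add: algebra_simps power2_eq_square[of s])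
  then have "(s - 1) * a\<^sup>2 = 4 / (1 + s)" using s by (simp add: field_simps)
  ultimately show "(1 - b) * a\<^sup>2 = b\<^sup>2"
    by (simp add: b' power2_eq_square)
qed

text \<open>The last conjunct is the equality case of \<open>feasible_alpha_square_le_Gam\<close>,
  preserved by \<open>nesterov_step\<close>. Strictness below 1 starts only at index 2, since the
  first term equals 1.\<close>

lemma nesterov_sequence:
  fixes \<alpha> :: "nat \<Rightarrow> real"
  assumes "\<alpha> 1 = 1"
    and "\<forall>k\<in>{1..<N}. \<alpha> (k + 1) = 2 / (1 + sqrt (1 + 4 / (\<alpha> k)\<^sup>2))"
    and "k \<in> {1..N}"
  shows "0 < \<alpha> k \<and> \<alpha> k \<le> 1 \<and> (k \<ge> 2 \<longrightarrow> \<alpha> k < 1) \<and> Gam \<alpha> k = (\<alpha> k)\<^sup>2"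
proof -
  from assms(3) have "1 \<le> k" by simp
  then show ?thesis using assms(3)
  proof (induction k rule: dec_induct)
    case base
    then show ?case using assms(1) by simp
  next
    case (step k)
    then have "0 < \<alpha> k" "Gam \<alpha> k = (\<alpha> k)\<^sup>2" by auto
    with nesterov_step[of "\<alpha> k" "\<alpha> (Suc k)"] assms(2) step.hyps step.prems
    show ?case by (simp add: Gam_Suc)
  qed
qed

text \<open>Termwise comparison, by induction on the index: the arbitrary sequence satisfies as an
  inequality the quadratic recursion that \<open>\<beta>\<close> satisfies as an equation.\<close>

lemma inverse_Gam_le_nesterov:
  assumes feas: "feasible L N \<alpha> \<delta> \<omega>"
    and one: "\<beta> 1 = 1"
    and rec: "\<forall>k\<in>{1..<N}. \<beta> (k + 1) = 2 / (1 + sqrt (1 + 4 / (\<beta> k)\<^sup>2))"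
    and k: "k \<in> {1..N}"
  shows "inverse (Gam \<alpha> k) \<le> inverse (Gam \<beta> k)"
proof -
  have gpos: "Gam \<alpha> k > 0" if "k \<in> {1..N}" for k
    using feas by (intro Gam_pos[OF _ that]) (simp add: feasible_def)
  note nest = nesterov_sequence[of \<beta> N, OF one rec]
  have clear_denom: "r\<^sup>2 * (1 - 1 / r) = r\<^sup>2 - r" if "r > 0" for r :: real
    using that by (simp add: field_simps power2_eq_square)
  from k have "1 \<le> k" by simp
  then have "Gam \<beta> k \<le> Gam \<alpha> k" using k
  proof (induction k rule: dec_induct)
    case (step k)
    have k: "k \<in> {1..N}" "Suc k \<in> {1..N}" "k \<ge> 1" using step by auto
    \<comment> \<open>Both \<open>t\<close> and \<open>s\<close> are inverse square roots of
      \<open>Gam\<close> at \<open>Suc k\<close>. For \<open>\<beta>\<close> this is exactly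
      \<open>1 / \<beta> (Suc k)\<close>; for \<open>\<alpha>\<close> only
      \<open>\<alpha> (Suc k) \<le> 1 / t\<close> is available.\<close>
    define t where "t = 1 / sqrt (Gam \<alpha> (Suc k))"
    define s where "s = 1 / \<beta> (Suc k)"
    have G: "Gam \<alpha> (Suc k) > 0" "Gam \<alpha> k > 0" using gpos k by auto
    have B: "\<beta> (Suc k) > 0" "\<beta> (Suc k) \<le> 1" "Gam \<beta> (Suc k) = (\<beta> (Suc k))\<^sup>2"
      "\<beta> k > 0" "Gam \<beta> k = (\<beta> k)\<^sup>2"
      using nest[OF k(1)] nest[OF k(2)] by auto
    have t: "t > 0" "Gam \<alpha> (Suc k) = 1 / t\<^sup>2"
      using G by (simp_all add: t_def power_divide)
    have s: "s \<ge> 1" "\<beta> (Suc k) = 1 / s" using B by (simp_all add: s_def)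
    have "\<alpha> (Suc k) \<le> 1 / t"
    proof (rule power2_le_imp_le)
      show "(\<alpha> (Suc k))\<^sup>2 \<le> (1 / t)\<^sup>2"
        using feasible_alpha_square_le_Gam[OF feas k(2)] t by (simp add: power_divide)
    qed (use t in simp)
    then have "(1 - 1 / t) * Gam \<alpha> k \<le> 1 / t\<^sup>2"
      using G t(2) Gam_Suc[OF k(3), of \<alpha>] mult_right_mono[of "1 - 1/t" "1 - \<alpha> (Suc k)" "Gam \<alpha> k"]
      by simp
    then have "t\<^sup>2 * ((1 - 1 / t) * Gam \<alpha> k) \<le> t\<^sup>2 * (1 / t\<^sup>2)"
      by (intro mult_left_mono) simp_all
    then have "(t\<^sup>2 - t) * Gam \<alpha> k \<le> 1"
      using t(1) clear_denom[OF t(1)] by (simp flip: mult.assoc)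
    then have A: "t\<^sup>2 - t \<le> 1 / Gam \<alpha> k" using G by (simp add: field_simps)
    have "(1 - 1 / s) * Gam \<beta> k = 1 / s\<^sup>2"
      using B(3) Gam_Suc[OF k(3), of \<beta>] s by (simp add: power_divide)
    then have "s\<^sup>2 * ((1 - 1 / s) * Gam \<beta> k) = 1" using s(1) by simp
    then have "(s\<^sup>2 - s) * Gam \<beta> k = 1"
      using s(1) clear_denom[of s] by (simp flip: mult.assoc)
    moreover have Bk: "Gam \<beta> k > 0" using B by simp
    ultimately have "s\<^sup>2 - s = 1 / Gam \<beta> k" by (simp add: field_simps)
    moreover have "1 / Gam \<alpha> k \<le> 1 / Gam \<beta> k"
      using step Bk by (intro divide_left_mono) auto
    ultimately have "t\<^sup>2 - t \<le> s\<^sup>2 - s" using A by linarith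
    then have "t \<le> s" using s(1) by (rule le_of_square_minus_self_le)
    then have "t\<^sup>2 \<le> s\<^sup>2" using t(1) by (intro power_mono) auto
    then have "1 / s\<^sup>2 \<le> 1 / t\<^sup>2" using t(1) by (intro frac_le) simp_all
    then show ?case using t(2) s(2) B(3) by (simp only: power_divide power_one)
  qed simp
  then show ?thesis using nest[OF k] by (intro le_imp_inverse_le) auto
qed

text \<open>Separates the step size from the \<open>\<alpha>\<close> sequence. One factor
  \<open>w\<close> comes from \<open>\<delta> 1\<close>, the other from the common value of
  \<open>\<omega>\<close>.\<close>

lemma complexity_bound_constant_stepsize:
  assumes "\<delta> 1 = w" and "\<forall>k\<in>{1..N}. \<omega> k = w"
  shows "complexity_bound L 0 x0 xstar M N \<alpha> \<delta> \<omega> =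
    (norm (x0 - xstar))\<^sup>2 / ((\<Sum>k=1..N. inverse (Gam \<alpha> k)) * (w * (w * (1 - L * w))))"
proof -
  have "(\<Sum>k=1..N. inverse (Gam \<alpha> k) * \<omega> k * (1 - L * \<omega> k)) =
        (\<Sum>k=1..N. inverse (Gam \<alpha> k)) * (w * (1 - L * w))"
    unfolding sum_distrib_right using assms(2) by (intro sum.cong) auto
  with assms(1) show ?thesis
    by (simp add: complexity_bound_def divide_inverse mult_ac)
qed

theorem theorem1:
  fixes f h chi :: "real ^ 'n \<Rightarrow> real" and D :: "(real ^ 'n) set"
    and Lf Lh L\<Psi> M :: real and x0 xstar :: "real ^ 'n" and N :: nat
    and \<alpha>' \<delta>' \<omega>' :: "nat \<Rightarrow> real" and w' :: real
  assumes "composite_problem f h chi D Lf Lh L\<Psi> xstar"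
    and "\<And>x. h x = 0" and "Lh = 0"
    and "N \<ge> 1"
    and "w' = 2 / (3 * L\<Psi>)"
    and "\<alpha>' 1 = 1"
    and "\<And>k. k \<in> {1..<N} \<Longrightarrow> \<alpha>' (k + 1) = 2 / (1 + sqrt (1 + 4 / (\<alpha>' k)\<^sup>2))"
    and "\<delta>' 1 = w'"
    and "\<And>k. k \<in> {1..<N} \<Longrightarrow> \<delta>' (k + 1) = w' / \<alpha>' (k + 1)"
    and "\<And>k. k \<in> {1..N} \<Longrightarrow> \<omega>' k = w'"
  shows "feasible L\<Psi> N \<alpha>' \<delta>' \<omega>' \<and>
    (\<forall>\<alpha> \<delta> \<omega>. feasible L\<Psi> N \<alpha> \<delta> \<omega> \<longrightarrow>
      complexity_bound L\<Psi> Lh x0 xstar M N \<alpha>' \<delta>' \<omega>' \<le> complexity_bound L\<Psi> Lh x0 xstar M N \<alpha> \<delta> \<omega>)"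
proof (intro conjI allI impI)
  note one = \<open>\<alpha>' 1 = 1\<close>
  have rec: "\<forall>k\<in>{1..<N}. \<alpha>' (k + 1) = 2 / (1 + sqrt (1 + 4 / (\<alpha>' k)\<^sup>2))"
    using assms(7) by blast
  have L: "L\<Psi> > 0" using assms(1) by (simp add: composite_problem_def)
  have w': "w' > 0" "w' < 1 / L\<Psi>" using L by (simp_all add: assms(5) field_simps)
  note nest = nesterov_sequence[of \<alpha>' N, OF one rec]
  have \<delta>': "\<delta>' k = w' / \<alpha>' k" if "k \<in> {1..N}" for k
  proof (cases "k = 1")
    case False
    with that have "k - 1 \<in> {1..<N}" by auto
    from assms(9)[OF this] that show ?thesis by simp
  qed (use one assms(8) in simp)
  have \<omega>': "\<forall>k\<in>{1..N}. \<omega>' k = w'" using assms(10) by blast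
  \<comment> \<open>Since \<open>Gam \<alpha>' k\<close> is the square of
    \<open>\<alpha>' k\<close>, all ratios coincide, so the monotonicity constraints hold with
    equality.\<close>
  have ratio: "\<alpha>' k / (\<delta>' k * Gam \<alpha>' k) = 1 / w'" if "k \<in> {1..N}" for k
    using nest[OF that] \<delta>'[OF that] w' by (simp add: power2_eq_square)
  show "feasible L\<Psi> N \<alpha>' \<delta>' \<omega>'"
    unfolding feasible_def
  proof (intro conjI ballI exI[of _ w'])
    fix k assume "k \<in> {1..<N}"
    then show "\<alpha>' (k + 1) / (\<delta>' (k + 1) * Gam \<alpha>' (k + 1)) \<le> \<alpha>' k / (\<delta>' k * Gam \<alpha>' k)"
      using ratio[of k] ratio[of "k + 1"] by simp
  next
    fix k assume k: "k \<in> {1..N}"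
    then have "\<alpha>' k > 0" using nest by blast
    then show "0 < \<delta>' k" "\<alpha>' k * \<delta>' k \<le> \<omega>' k"
      unfolding \<delta>'[OF k] using \<omega>' k w'(1) by simp_all
    show "\<omega>' k = w'" "0 < \<omega>' k" "\<omega>' k < 1 / L\<Psi>" using \<omega>' k w' by simp_all
  next
    fix k assume "k \<in> {2..N}"
    then have "k \<in> {1..N}" "2 \<le> k" by simp_all
    then show "0 < \<alpha>' k" "\<alpha>' k < 1" using nest by blast+
  qed (rule one w'(1) assms(8))+
  fix \<alpha> \<delta> \<omega>
  assume feas: "feasible L\<Psi> N \<alpha> \<delta> \<omega>"
  then obtain w where w: "w > 0" "\<delta> 1 = w" "\<forall>k\<in>{1..N}. \<omega> k = w"
    unfolding feasible_def by blast
  have one_mem: "1 \<in> {1..N}" using \<open>N \<ge> 1\<close> by simp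
  with feas have "\<omega> 1 < 1 / L\<Psi>" unfolding feasible_def by blast
  then have "w < 1 / L\<Psi>" using w(3) one_mem by simp
  then have "1 - L\<Psi> * w > 0" using L by (simp add: field_simps)
  then have wpos: "w * (w * (1 - L\<Psi> * w)) > 0" using w(1) by simp
  have wle: "w * (w * (1 - L\<Psi> * w)) \<le> w' * (w' * (1 - L\<Psi> * w'))"
    by (rule stepsize_product_le[OF L w(1) assms(5)])
  define S S' where "S = (\<Sum>k=1..N. inverse (Gam \<alpha> k))" and "S' = (\<Sum>k=1..N. inverse (Gam \<alpha>' k))"
  have "S \<le> S'" unfolding S_def S'_def
    by (intro sum_mono inverse_Gam_le_nesterov[OF feas one rec])
  moreover have "S > 0"
    unfolding S_def using \<open>N \<ge> 1\<close> feas
    by (intro sum_pos) (auto simp: feasible_def intro!: Gam_pos[of N])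
  ultimately have "S * (w * (w * (1 - L\<Psi> * w))) \<le> S' * (w' * (w' * (1 - L\<Psi> * w')))"
    and "0 < S * (w * (w * (1 - L\<Psi> * w)))"
    using mult_mono[OF _ wle, of S S'] mult_pos_pos[OF _ wpos, of S] wpos by linarith+
  \<comment> \<open>The case \<open>x0 = xstar\<close> is covered: the numerator need only be
    nonnegative, while the smaller denominator is strictly positive because
    \<open>w < 1 / L\<Psi>\<close>.\<close>
  then have "(norm (x0 - xstar))\<^sup>2 / (S' * (w' * (w' * (1 - L\<Psi> * w'))))
      \<le> (norm (x0 - xstar))\<^sup>2 / (S * (w * (w * (1 - L\<Psi> * w))))"
    by (intro frac_le) simp_all
  then show "complexity_bound L\<Psi> Lh x0 xstar M N \<alpha>' \<delta>' \<omega>'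
      \<le> complexity_bound L\<Psi> Lh x0 xstar M N \<alpha> \<delta> \<omega>"
    by (simp only: \<open>Lh = 0\<close> S_def S'_def complexity_bound_constant_stepsize[of \<delta> w N \<omega>, OF w(2,3)]
        complexity_bound_constant_stepsize[of \<delta>' w' N \<omega>', OF assms(8) \<omega>'])
qed

end
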